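(* Let $(R,\mathfrak{m})$ be a finite commutative local ring with identity, with $m=|\mathfrak{m}|$ and residue field $R/\mathfrak{m}\simeq\mathbb{F}_q$. Let $k\in\mathbb{N}$ be such that $(k,q-1)\mid \frac{q-1}{2}$. If $(k,q)=1$, then $$\mathcal{K}_{\ell}(G_R(k))=\mathcal{K}_{\ell}(\Gamma(k,q))\cdot m^{\ell}\quad\text{for all }\ell\in\mathbb{N}.$$
   Context: For a finite commutative ring $R$ with identity and $k\in\mathbb{N}$, let $U_R(k)=\{x^k : x\in R^*\}$ (where $R^*$ is the unit group) and let $G_R(k)=\mathrm{Cay}(R,U_R(k))$ be the Cayley graph with vertex set $R$, where $v,w$ are joined when $w-v\in U_R(k)$ (under the stated hypotheses $U_R(k)=-U_R(k)$, so the graph is undirected). The generalized Paley graph is $\Gamma(k,q)=G_{\mathbb{F}_q}(k)=\mathrm{Cay}(\mathbb{F}_q,\{x^k: x\in\mathbb{F}_q^*\})$. For a graph $H$, $\mathcal{K}_{\ell}(H)$ denotes the number of cliques (complete subgraphs) of $H$ with exactly $\ell$ vertices. $(a,b)$ denotes the greatest common divisor. *)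

theory Defs
  imports "HOL-Algebra.QuotRing" "Graph_Theory.Kuratowski"
begin

locale local_cring = cring R + maximalideal M R for M and R (structure) +
  assumes maximalideal_unique: "maximalideal I R \<Longrightarrow> I = M"

definition unit_powers :: "('a, 'm) ring_scheme \<Rightarrow> nat \<Rightarrow> 'a set" where
  "unit_powers R k = {x [^]\<^bsub>R\<^esub> k | x. x \<in> Units R}"

definition cayley_graph :: "('a, 'm) ring_scheme \<Rightarrow> 'a set \<Rightarrow> 'a pair_pre_digraph" where
  "cayley_graph R S =
     \<lparr> pverts = carrier R,
       parcs = {(v, w). v \<in> carrier R \<and> w \<in> carrier R \<and> w \<ominus>\<^bsub>R\<^esub> v \<in> S} \<rparr>"

definition unit_power_graph :: "('a, 'm) ring_scheme \<Rightarrow> nat \<Rightarrow> 'a pair_pre_digraph" where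
  "unit_power_graph R k = cayley_graph R (unit_powers R k)"

text \<open>
  The finite field enters the generalized Paley graph as a ring structure \<open>F\<close>: the graph usually
  written \<open>\<Gamma>(k, q)\<close> is \<open>paley_graph k F\<close> for any field \<open>F\<close> with \<open>q\<close> elements.
\<close>

definition paley_graph :: "nat \<Rightarrow> ('a, 'm) ring_scheme \<Rightarrow> 'a pair_pre_digraph" where
  "paley_graph k F = unit_power_graph F k"

text \<open>
  An undirected graph is a symmetric digraph, so a complete subgraph contains both arcs between
  any two of its distinct vertices and no loop. Arcs are pairs of vertices, hence a complete
  subgraph is determined by its vertex set. The empty graph counts as the complete graph on
  \<open>0\<close> vertices.
\<close>

definition num_cliques :: "nat \<Rightarrow> 'a pair_pre_digraph \<Rightarrow> nat" where
  "num_cliques l H =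
     card {C :: 'a pair_pre_digraph.
             subgraph (with_proj C) (with_proj H) \<and> complete_digraph l (with_proj C)}"

end

theory Submission
  imports Defs "HOL-Algebra.Multiplicative_Group"
begin

text \<open>
  Let \<open>h\<close> be the projection of \<open>R\<close> onto its residue field. For \<open>a \<noteq> 0\<close>, the \<open>k\<close>-th power map sends
  the fibre of \<open>h\<close> over \<open>a\<close> to the fibre over \<open>a ^ k\<close>. It is injective there: the cofactor of
  \<open>u - v\<close> in \<open>u ^ k - v ^ k\<close> reduces to \<open>k a ^ (k - 1)\<close>, which is nonzero because \<open>k\<close> is coprime
  to \<open>q\<close>, and is therefore a unit. Both fibres have \<open>m\<close> elements, so the map is onto, and hence an
  element of \<open>R\<close> is a \<open>k\<close>-th power of a unit iff its residue is. The graph of \<open>R\<close> is thus the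
  blow-up of the graph of the field in which every vertex is replaced by \<open>m\<close> independent ones, and
  a clique of the blow-up is a clique of the base together with one of \<open>m\<close> lifts of each vertex.
\<close>

section \<open>Cliques in blow-ups\<close>

text \<open>Cliques as bare vertex sets, so that maps of vertices act on them by images. Finiteness
  is explicit because \<open>card\<close> of an infinite set is 0, which would matter for
  \<open>l = 0\<close>.\<close>

definition clique_sets :: "nat \<Rightarrow> 'a pair_pre_digraph \<Rightarrow> 'a set set" where
  "clique_sets l H = {S. S \<subseteq> pverts H \<and> finite S \<and> card S = l \<and>
     (\<forall>u\<in>S. \<forall>v\<in>S. u \<noteq> v \<longrightarrow> (u, v) \<in> parcs H)}"

text \<open>\<open>?K S\<close>, with all arcs between distinct vertices of \<open>S\<close>, is the
  only complete digraph on \<open>S\<close>. Well-formedness of \<open>H\<close> enters because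
  \<open>subgraph\<close> demands it of both graphs.\<close>

lemma num_cliques_eq_card_clique_sets:
  assumes "pair_wf_digraph H"
  shows "num_cliques l H = card (clique_sets l H)"
proof -
  let ?K = "\<lambda>S. \<lparr>pverts = S, parcs = {(u, v). (u, v) \<in> S \<times> S \<and> u \<noteq> v}\<rparr>"
  have wf: "pair_wf_digraph (?K S)" for S :: "'a set"
    by unfold_locales auto
  have "{C. subgraph (with_proj C) (with_proj H) \<and> complete_digraph l (with_proj C)}
      = ?K ` clique_sets l H"
  proof (intro equalityI subsetI)
    fix C assume "C \<in> {C. subgraph (with_proj C) (with_proj H) \<and> complete_digraph l (with_proj C)}"
    then have "pverts C \<subseteq> pverts H" "parcs C \<subseteq> parcs H" "finite (pverts C)" "card (pverts C) = l"
      and C: "parcs C = {(u, v). (u, v) \<in> pverts C \<times> pverts C \<and> u \<noteq> v}"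
      by (auto simp: subgraph_def complete_digraph_pair_def)
    then have "pverts C \<in> clique_sets l H"
      by (auto simp: clique_sets_def)
    moreover from C have "C = ?K (pverts C)"
      by (cases C) simp
    ultimately show "C \<in> ?K ` clique_sets l H"
      by blast
  next
    fix C assume "C \<in> ?K ` clique_sets l H"
    then show "C \<in> {C. subgraph (with_proj C) (with_proj H) \<and> complete_digraph l (with_proj C)}"
      using assms wf
      by (auto simp: clique_sets_def subgraph_def complete_digraph_pair_def compatible_def
          wf_digraph_wp_iff)
  qed
  moreover have "inj_on ?K (clique_sets l H)"
    by (auto intro: inj_onI)
  ultimately show ?thesis
    unfolding num_cliques_def by (simp add: card_image)
qed

text \<open>Cliques of \<open>G\<close> correspond to pairs of a clique \<open>C\<close> of
  \<open>H\<close> and a section of \<open>h\<close> over \<open>C\<close>; each \<open>C\<close>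
  has \<open>m ^ l\<close> sections.\<close>

lemma card_clique_sets_blowup:
  fixes h :: "'a \<Rightarrow> 'b"
  assumes fin: "finite (pverts G)" "finite (pverts H)"
    and h: "h \<in> pverts G \<rightarrow> pverts H"
    and fibre: "\<And>w. w \<in> pverts H \<Longrightarrow> card {v \<in> pverts G. h v = w} = m"
    and arc: "\<And>u v. u \<in> pverts G \<Longrightarrow> v \<in> pverts G \<Longrightarrow> (u, v) \<in> parcs G \<longleftrightarrow> (h u, h v) \<in> parcs H"
    and loopfree: "\<And>w. (w, w) \<notin> parcs H"
  shows "card (clique_sets l G) = card (clique_sets l H) * m ^ l"
proof -
  let ?F = "\<lambda>w. {v \<in> pverts G. h v = w}"
  \<comment> \<open>\<open>PiE\<close> fixes the values outside \<open>C\<close>, so a section is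
    determined by its values on \<open>C\<close> and \<open>?g\<close> can be injective.\<close>
  let ?A = "SIGMA C:clique_sets l H. PiE C ?F"
  let ?g = "\<lambda>(C, f). f ` C"
  have fin_cliques: "finite (clique_sets l H)"
    by (rule finite_subset[of _ "Pow (pverts H)"]) (auto simp: clique_sets_def fin)
  have inj: "inj_on ?g ?A"
  proof (rule inj_onI, clarsimp)
    fix C f C' f'
    assume f: "f \<in> PiE C ?F" and f': "f' \<in> PiE C' ?F" and eq: "f ` C = f' ` C'"
    have hf: "h (f x) = x" if "x \<in> C" for x using f that by (auto simp: PiE_def Pi_def)
    have hf': "h (f' x) = x" if "x \<in> C'" for x using f' that by (auto simp: PiE_def Pi_def)
    \<comment> \<open>Applying \<open>h\<close> to the lifted clique recovers the base
      clique.\<close>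
    have "C = h ` f ` C" using hf by (simp add: image_image)
    also have "\<dots> = C'" unfolding eq using hf' by (simp add: image_image)
    finally have C: "C = C'" .
    have "f x = f' x" if "x \<in> C" for x
    proof -
      have "f x \<in> f' ` C'" using that by (simp flip: eq)
      then obtain y where "y \<in> C'" "f x = f' y" by (rule imageE)
      then show ?thesis using hf[OF that] hf'[of y] by metis
    qed
    then show "C = C' \<and> f = f'"
      using f f' C by (auto intro: PiE_ext)
  qed
  have image: "?g ` ?A = clique_sets l G"
  proof (intro equalityI subsetI)
    fix S assume "S \<in> ?g ` ?A"
    then obtain C f where C: "C \<in> clique_sets l H" and f: "f \<in> PiE C ?F" and S: "S = f ` C"
      by auto
    have hf: "h (f x) = x" and fG: "f x \<in> pverts G" if "x \<in> C" for x
      using f that by (auto simp: PiE_def Pi_def)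
    have "inj_on f C" by (metis hf inj_onI)
    then have "card S = l"
      using C S by (simp add: card_image clique_sets_def)
    moreover have "(u, v) \<in> parcs G" if "u \<in> S" "v \<in> S" "u \<noteq> v" for u v
    proof -
      from that S obtain x y where xy: "x \<in> C" "y \<in> C" "u = f x" "v = f y" by auto
      then have "(x, y) \<in> parcs H"
        using C that by (auto simp: clique_sets_def)
      then show ?thesis
        using xy arc fG hf by simp
    qed
    ultimately show "S \<in> clique_sets l G"
      using C fG S by (auto simp: clique_sets_def)
  next
    fix S assume S: "S \<in> clique_sets l G"
    then have SG: "S \<subseteq> pverts G" and finS: "finite S" by (auto simp: clique_sets_def)
    have arcS: "(h u, h v) \<in> parcs H" if "u \<in> S" "v \<in> S" "u \<noteq> v" for u v
    proof -
      have "(u, v) \<in> parcs G" "u \<in> pverts G" "v \<in> pverts G"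
        using S that by (auto simp: clique_sets_def)
      then show ?thesis
        using arc by simp
    qed
    \<comment> \<open>Two distinct vertices of \<open>S\<close> in one fibre would be adjacent, and
      their arc would map to a loop of \<open>H\<close>.\<close>
    have injS: "inj_on h S"
      by (rule inj_onI) (metis arcS loopfree)
    let ?f = "restrict (inv_into S h) (h ` S)"
    have "h ` S \<in> clique_sets l H"
      using S h injS arcS by (auto simp: clique_sets_def card_image)
    moreover have "?f \<in> PiE (h ` S) ?F"
      using SG injS by auto
    moreover have "?f ` h ` S = S"
      using injS by (simp add: image_image)
    ultimately show "S \<in> ?g ` ?A"
      by (intro image_eqI[of _ _ "(h ` S, ?f)"]) auto
  qed
  have card_PiE: "card (PiE C ?F) = m ^ l" if C: "C \<in> clique_sets l H" for C
  proof -
    have "card (PiE C ?F) = (\<Prod>w\<in>C. card (?F w))"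
      using C by (simp add: card_PiE clique_sets_def)
    also have "\<dots> = (\<Prod>w\<in>C. m)"
      using C fibre by (intro prod.cong) (auto simp: clique_sets_def)
    also have "\<dots> = m ^ l"
      using C by (simp add: clique_sets_def)
    finally show ?thesis .
  qed
  have "card (clique_sets l G) = card ?A"
    using card_image[OF inj] image by simp
  also have "\<dots> = (\<Sum>C\<in>clique_sets l H. card (PiE C ?F))"
    using fin fin_cliques
    by (intro card_SigmaI ballI finite_PiE) (auto simp: clique_sets_def)
  also have "\<dots> = card (clique_sets l H) * m ^ l"
    using card_PiE by simp
  finally show ?thesis .
qed

section \<open>Powers of units under reduction\<close>

text \<open>A nonunit generates a proper ideal; by finiteness this lies in a maximal one, and the
  only maximal ideal is \<open>M\<close>.\<close>

lemma (in local_cring) nonunit_mem_maximalideal: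
  assumes fin: "finite (carrier R)" and x: "x \<in> carrier R" "x \<notin> Units R"
  shows "x \<in> M"
proof -
  let ?P = "{J. ideal J R \<and> x \<in> J \<and> J \<noteq> carrier R}"
  have sub: "J \<subseteq> carrier R" if "ideal J R" for J
    using additive_subgroup.a_subset[OF ideal.axioms(1)[OF that]] .
  have "finite ?P"
    by (rule finite_subset[of _ "Pow (carrier R)"]) (use fin sub in auto)
  moreover have "PIdl x \<in> ?P"
  proof -
    have "\<one> \<notin> PIdl x"
      using x by (auto simp: cgenideal_def Units_def m_comm)
    then have "PIdl x \<noteq> carrier R"
      using one_closed by blast
    then show ?thesis
      using cgenideal_ideal[OF x(1)] cgenideal_self[OF x(1)] by simp
  qed
  ultimately have "\<exists>J\<in>?P. \<forall>I\<in>?P. J \<subseteq> I \<longrightarrow> J = I"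
    by (intro finite_has_maximal) auto
  then obtain J where J: "J \<in> ?P" and max: "\<And>I. I \<in> ?P \<Longrightarrow> J \<subseteq> I \<Longrightarrow> J = I"
    by auto
  have "maximalideal J R"
  proof (rule maximalidealI)
    show "ideal J R" "carrier R \<noteq> J" using J by auto
    show "I = J \<or> I = carrier R" if "ideal I R" "J \<subseteq> I" for I
      using that J max[of I] by auto
  qed
  then show ?thesis
    using maximalideal_unique J by blast
qed

text \<open>Composing the projection with the given isomorphism trades the quotient for a surjection
  with kernel \<open>M\<close>, whose fibres can be counted directly.\<close>

lemma (in local_cring) residue_hom:
  fixes F :: "('c, 'd) ring_scheme"
  assumes "R Quot M \<simeq> F" "ring F"
  obtains h where "h \<in> ring_hom R F" "h ` carrier R = carrier F" "a_kernel R F h = M"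
proof -
  obtain p where p: "p \<in> ring_hom (R Quot M) F" "bij_betw p (carrier (R Quot M)) (carrier F)"
    using assms(1) by (auto simp: is_ring_iso_def ring_iso_def)
  define h where "h = p \<circ> (+>) M"
  have hom: "h \<in> ring_hom R F"
    unfolding h_def using ring_hom_trans[OF rcos_ring_hom p(1)] .
  interpret F: ring F by fact
  interpret h: ring_hom_ring R F h
    by (rule ring_hom_ringI2[OF ring_axioms F.ring_axioms hom])
  have carrier_Quot: "carrier (R Quot M) = (+>) M ` carrier R"
    by (auto simp: FactRing_def A_RCOSETS_def')
  have surj: "h ` carrier R = carrier F"
    using p(2) by (simp add: h_def carrier_Quot image_image bij_betw_def)
  have kernel: "a_kernel R F h = M"
  proof -
    have "h x = \<zero>\<^bsub>F\<^esub> \<longleftrightarrow> x \<in> M" if x: "x \<in> carrier R" for x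
    proof -
      have "h x = \<zero>\<^bsub>F\<^esub> \<longleftrightarrow> h x = h \<zero>"
        by simp
      \<comment> \<open>Injectivity of \<open>p\<close> turns equality of values into equality of
        cosets.\<close>
      also have "\<dots> \<longleftrightarrow> M +> x = M +> \<zero>"
        using p(2) x unfolding h_def bij_betw_def by (auto simp: carrier_Quot inj_on_eq_iff)
      also have "\<dots> \<longleftrightarrow> x \<in> M"
        unfolding a_coset_add_zero[OF a_subset]
        using a_coset_join1[OF _ x a_subgroup] a_coset_join2[OF x a_subgroup] by (rule iffI)
      finally show ?thesis .
    qed
    then show ?thesis
      using a_subset unfolding a_kernel_def' by blast
  qed
  show thesis
    by (rule that[OF hom surj kernel])
qed

text \<open>The additive order of \<open>x\<close> would divide both \<open>n\<close> and the group
  order, hence be 1. For a finite field this gives \<open>k a ^ k \<noteq> 0\<close> without mention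
  of the characteristic.\<close>

lemma (in abelian_group) add_pow_coprime_order_nonzero:
  assumes "finite (carrier G)" "coprime n (card (carrier G))" "x \<in> carrier G" "x \<noteq> \<zero>"
  shows "[n] \<cdot> x \<noteq> \<zero>"
proof
  assume "[n] \<cdot> x = \<zero>"
  then have "add.ord x dvd n"
    using assms(3) add.pow_eq_id[of x n] by (simp add: add_pow_def)
  moreover have "add.ord x dvd card (carrier G)"
    using add.ord_dvd_group_order[of x] assms(3) by (simp add: order_def)
  ultimately have "add.ord x = 1"
    using assms(2) coprime_common_divisor_nat by blast
  then show False
    using add.ord_eq_1[of x] assms by simp
qed

section \<open>Fibres of ring homomorphisms\<close>

context ring_hom_ring
begin

lemma vimage_singleton_eq_coset:
  assumes "x \<in> carrier R"
  shows "{y \<in> carrier R. h y = h x} = a_kernel R S h +> x"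
proof -
  interpret K: ideal "a_kernel R S h" R
    by (rule kernel_is_ideal)
  show ?thesis
    using assms rcos_imp_homeq homeq_imp_rcos R.a_r_coset_subset_G[OF K.a_subset] by blast
qed

text \<open>A nonempty fibre is a coset of the kernel, and all cosets have the same size.\<close>

lemma card_vimage_singleton:
  assumes "finite (carrier R)" "a \<in> h ` carrier R"
  shows "card {x \<in> carrier R. h x = a} = card (a_kernel R S h)"
proof -
  interpret K: ideal "a_kernel R S h" R
    by (rule kernel_is_ideal)
  obtain x where x: "x \<in> carrier R" "a = h x" using assms(2) by blast
  have "a_kernel R S h +> x \<in> a_rcosets (a_kernel R S h)"
    using x K.a_subset by (intro R.a_rcosetsI)
  then show ?thesis
    using R.a_card_cosets_equal[OF _ K.a_subset assms(1)] vimage_singleton_eq_coset x by simp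
qed

end

section \<open>Powers of units along a homomorphism\<close>

context ring_hom_cring
begin

lemma hom_Units:
  assumes "x \<in> Units R"
  shows "h x \<in> Units S"
proof -
  have "h x \<otimes>\<^bsub>S\<^esub> h (inv x) = \<one>\<^bsub>S\<^esub>" "h (inv x) \<otimes>\<^bsub>S\<^esub> h x = \<one>\<^bsub>S\<^esub>"
    using assms by (simp_all flip: hom_mult add: R.Units_closed)
  moreover have "h x \<in> carrier S" "h (inv x) \<in> carrier S"
    using assms by (simp_all add: R.Units_closed)
  ultimately show ?thesis
    unfolding Units_def by blast
qed

text \<open>Here \<open>s\<close> is the sum of the \<open>u ^ i v ^ j\<close> with
  \<open>i + j = k - 1\<close>, which reduces to \<open>k a ^ (k - 1)\<close>. The extra factor
  \<open>a\<close> avoids the exponent \<open>k - 1\<close>, so that \<open>k = 0\<close> (empty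
  sum) is covered.\<close>

lemma pow_diff_factor:
  fixes k :: nat
  assumes uv: "u \<in> carrier R" "v \<in> carrier R" "h u = a" "h v = a"
  shows "\<exists>s\<in>carrier R. u [^] k \<ominus> v [^] k = (u \<ominus> v) \<otimes> s \<and> h s \<otimes>\<^bsub>S\<^esub> a = [k] \<cdot>\<^bsub>S\<^esub> (a [^]\<^bsub>S\<^esub> k)"
proof (induction k)
  case 0
  show ?case
    using uv by (intro bexI[of _ \<zero>]) (auto simp: R.r_right_minus_eq)
next
  case (Suc k)
  have a: "a \<in> carrier S" using uv by auto
  obtain s where s: "s \<in> carrier R" "u [^] k \<ominus> v [^] k = (u \<ominus> v) \<otimes> s"
    and hs: "h s \<otimes>\<^bsub>S\<^esub> a = [k] \<cdot>\<^bsub>S\<^esub> (a [^]\<^bsub>S\<^esub> k)"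
    using Suc by blast
  \<comment> \<open>Adding and subtracting \<open>v ^ k u\<close> exposes the recursion for the
    cofactor: \<open>s\<close> becomes \<open>s u + v ^ k\<close>.\<close>
  have "u [^] Suc k \<ominus> v [^] Suc k = (u [^] k \<ominus> v [^] k) \<otimes> u \<oplus> (u \<ominus> v) \<otimes> v [^] k"
  proof -
    have "u [^] k \<in> carrier R" "v [^] k \<in> carrier R" using uv by auto
    then show ?thesis using uv(1,2) unfolding Group.nat_pow_Suc by algebra
  qed
  also have "\<dots> = (u \<ominus> v) \<otimes> (s \<otimes> u \<oplus> v [^] k)"
    using s uv(1,2) by (simp add: R.r_distr R.m_assoc)
  finally have 1: "u [^] Suc k \<ominus> v [^] Suc k = (u \<ominus> v) \<otimes> (s \<otimes> u \<oplus> v [^] k)" .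
  have "h (s \<otimes> u \<oplus> v [^] k) \<otimes>\<^bsub>S\<^esub> a = (h s \<otimes>\<^bsub>S\<^esub> a \<oplus>\<^bsub>S\<^esub> a [^]\<^bsub>S\<^esub> k) \<otimes>\<^bsub>S\<^esub> a"
    using s uv by simp
  also have "\<dots> = [Suc k] \<cdot>\<^bsub>S\<^esub> (a [^]\<^bsub>S\<^esub> k) \<otimes>\<^bsub>S\<^esub> a"
    using a by (simp add: hs S.add.nat_pow_Suc)
  also have "\<dots> = [Suc k] \<cdot>\<^bsub>S\<^esub> (a [^]\<^bsub>S\<^esub> Suc k)"
    using a by (simp add: S.add_pow_ldistr S.l_distr)
  finally show ?case
    using 1 s uv by blast
qed

lemma mem_unit_powers_iff:
  assumes fin: "finite (carrier R)" and field: "field S" and surj: "h ` carrier R = carrier S"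
    and unit: "\<And>x. x \<in> carrier R \<Longrightarrow> h x \<noteq> \<zero>\<^bsub>S\<^esub> \<Longrightarrow> x \<in> Units R"
    and cop: "coprime k (card (carrier S))" and x: "x \<in> carrier R"
  shows "x \<in> unit_powers R k \<longleftrightarrow> h x \<in> unit_powers S k"
proof
  assume "x \<in> unit_powers R k"
  then obtain y where "y \<in> Units R" "x = y [^] k"
    by (auto simp: unit_powers_def)
  moreover from this have "h x = h y [^]\<^bsub>S\<^esub> k"
    by (simp add: R.Units_closed)
  ultimately show "h x \<in> unit_powers S k"
    using hom_Units by (auto simp: unit_powers_def)
next
  interpret S: field S by fact
  assume "h x \<in> unit_powers S k"
  then obtain a where a: "a \<in> Units S" and hx: "h x = a [^]\<^bsub>S\<^esub> k"
    by (auto simp: unit_powers_def)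
  have aS: "a \<in> carrier S" and a0: "a \<noteq> \<zero>\<^bsub>S\<^esub>"
    using a by (auto simp: S.field_Units)
  have ak: "a [^]\<^bsub>S\<^esub> k \<in> carrier S" "a [^]\<^bsub>S\<^esub> k \<noteq> \<zero>\<^bsub>S\<^esub>"
    using S.Units_pow_closed[OF a, of k] by (auto simp: S.field_Units)
  let ?A = "{y \<in> carrier R. h y = a}" and ?B = "{y \<in> carrier R. h y = a [^]\<^bsub>S\<^esub> k}"
  have "inj_on (\<lambda>y. y [^] k) ?A"
  proof (rule inj_onI)
    fix u v assume "u \<in> ?A" "v \<in> ?A" and eq: "u [^] k = v [^] k"
    then have uv: "u \<in> carrier R" "v \<in> carrier R" "h u = a" "h v = a" by auto
    then obtain s where s: "s \<in> carrier R" "u [^] k \<ominus> v [^] k = (u \<ominus> v) \<otimes> s"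
      and hs: "h s \<otimes>\<^bsub>S\<^esub> a = [k] \<cdot>\<^bsub>S\<^esub> (a [^]\<^bsub>S\<^esub> k)"
      using pow_diff_factor[of u v a k] by blast
    have "finite (carrier S)"
      using fin surj by (metis finite_imageI)
    then have "[k] \<cdot>\<^bsub>S\<^esub> (a [^]\<^bsub>S\<^esub> k) \<noteq> \<zero>\<^bsub>S\<^esub>"
      using S.add_pow_coprime_order_nonzero[OF _ cop ak] by simp
    \<comment> \<open>A product with nonzero value has \<open>h s\<close> nonzero, so
      \<open>unit\<close> applies to \<open>s\<close>.\<close>
    then have "s \<in> Units R"
      using hs s(1) aS by (intro unit) auto
    \<comment> \<open>The zero is written as a multiple of \<open>s\<close> so that the unit
      \<open>s\<close> can be cancelled.\<close>
    moreover have "s \<otimes> (u \<ominus> v) = s \<otimes> \<zero>"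
    proof -
      have "s \<otimes> (u \<ominus> v) = v [^] k \<ominus> v [^] k"
        using s(1) uv unfolding s(2)[unfolded eq] by (intro R.m_comm) auto
      also have "\<dots> = s \<otimes> \<zero>"
        using s(1) uv by (simp add: a_minus_def R.r_neg)
      finally show ?thesis .
    qed
    ultimately have "u \<ominus> v = \<zero>"
      using uv by (subst (asm) R.Units_l_cancel) auto
    then show "u = v"
      using uv by (simp add: R.r_right_minus_eq)
  qed
  moreover have "(\<lambda>y. y [^] k) ` ?A \<subseteq> ?B"
    by auto
  moreover have "card ?A = card ?B"
    using ring.card_vimage_singleton fin surj aS ak by simp
  moreover have "finite ?B"
    using fin by simp
  \<comment> \<open>An injection between finite sets of equal size is onto, so \<open>x\<close> in
    \<open>?B\<close> has a root in \<open>?A\<close>.\<close>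
  ultimately have "(\<lambda>y. y [^] k) ` ?A = ?B"
    by (intro card_subset_eq) (simp_all only: card_image)
  then obtain y where y: "y \<in> carrier R" "h y = a" "x = y [^] k"
    using x hx by blast
  then show "x \<in> unit_powers R k"
    using unit[of y] a0 unfolding unit_powers_def by blast
qed

end

section \<open>The graphs of unit powers and the count of their cliques\<close>

lemma pair_wf_digraph_unit_power_graph: "pair_wf_digraph (unit_power_graph R k)"
  by unfold_locales (auto simp: unit_power_graph_def cayley_graph_def)

text \<open>A loop would make \<open>w - w\<close>, which is zero, a power of a unit and hence a
  unit.\<close>

lemma (in field) loopfree_unit_power_graph: "(w, w) \<notin> parcs (unit_power_graph R k)"
proof
  assume "(w, w) \<in> parcs (unit_power_graph R k)"
  then have "\<zero> \<in> unit_powers R k"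
    by (auto simp: unit_power_graph_def cayley_graph_def a_minus_def r_neg)
  then obtain x where "x \<in> Units R" "\<zero> = x [^] k"
    by (auto simp: unit_powers_def)
  then have "\<zero> \<in> Units R"
    using Units_pow_closed by simp
  then show False
    by (simp add: field_Units)
qed

theorem theorem2p8:
  fixes R :: "('a, 'r) ring_scheme" and M :: "'a set"
    and F :: "('b, 's) ring_scheme" and q m k :: nat
  assumes "local_cring M R"
    and "finite (carrier R)"
    and "m = card M"
    and "field F"
    and "card (carrier F) = q"
    and "R Quot M \<simeq> F"
    and "even (q - 1)"
    and "gcd k (q - 1) dvd (q - 1) div 2"
    and "coprime k q"
  shows "\<forall>l. num_cliques l (unit_power_graph R k) = num_cliques l (paley_graph k F) * m ^ l"
proof
  fix l
  interpret local_cring M R by fact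
  interpret F: field F by fact
  obtain h where h: "h \<in> ring_hom R F" and surj: "h ` carrier R = carrier F"
    and kernel: "a_kernel R F h = M"
    using residue_hom[OF assms(6) F.ring_axioms] .
  interpret h: ring_hom_cring R F h
    by unfold_locales (rule h)
  \<comment> \<open>A nonzero residue means that \<open>x\<close> lies outside the kernel
    \<open>M\<close>, which contains every nonunit.\<close>
  have unit: "x \<in> Units R" if "x \<in> carrier R" "h x \<noteq> \<zero>\<^bsub>F\<^esub>" for x
    using that nonunit_mem_maximalideal[OF assms(2)] kernel unfolding a_kernel_def' by blast
  have "card (clique_sets l (unit_power_graph R k)) =
      card (clique_sets l (unit_power_graph F k)) * m ^ l"
  proof (rule card_clique_sets_blowup[where h = h])
    show "finite (pverts (unit_power_graph R k))"
      using assms(2) by (simp add: unit_power_graph_def cayley_graph_def)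
    show "finite (pverts (unit_power_graph F k))"
      using assms(2) surj by (simp add: unit_power_graph_def cayley_graph_def flip: surj)
    show "h \<in> pverts (unit_power_graph R k) \<rightarrow> pverts (unit_power_graph F k)"
      by (auto simp: unit_power_graph_def cayley_graph_def)
    show "card {v \<in> pverts (unit_power_graph R k). h v = w} = m"
      if "w \<in> pverts (unit_power_graph F k)" for w
      using that h.ring.card_vimage_singleton[OF assms(2)] assms(3) surj kernel
      by (simp add: unit_power_graph_def cayley_graph_def)
    show "(u, v) \<in> parcs (unit_power_graph R k) \<longleftrightarrow> (h u, h v) \<in> parcs (unit_power_graph F k)"
      if "u \<in> pverts (unit_power_graph R k)" "v \<in> pverts (unit_power_graph R k)" for u v
    proof -
      have "u \<in> carrier R" "v \<in> carrier R"
        using that by (auto simp: unit_power_graph_def cayley_graph_def)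
      \<comment> \<open>Adjacency depends only on the difference, which \<open>h\<close> preserves,
        so the criterion for unit powers transfers arcs.\<close>
      moreover from this have "h (v \<ominus>\<^bsub>R\<^esub> u) = h v \<ominus>\<^bsub>F\<^esub> h u"
        by (simp add: a_minus_def)
      ultimately show ?thesis
        using h.mem_unit_powers_iff[OF assms(2,4) surj unit, of k "v \<ominus>\<^bsub>R\<^esub> u"] assms(5,9)
        by (simp add: unit_power_graph_def cayley_graph_def)
    qed
    show "(w, w) \<notin> parcs (unit_power_graph F k)" for w
      by (rule F.loopfree_unit_power_graph)
  qed
  then show "num_cliques l (unit_power_graph R k) = num_cliques l (paley_graph k F) * m ^ l"
    by (simp add: paley_graph_def num_cliques_eq_card_clique_sets pair_wf_digraph_unit_power_graph)
qed

end
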